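(* Let $L$ be a frame and let $e\colon L\to L^\delta$ be a canonical extension of $L$. Then $L^\delta$ is isomorphic to the poset of those filters of $L$ that are obtained as intersections of (sets of) Scott-open filters on $L$, ordered by reverse inclusion.
   Context: A frame is a complete lattice in which finite meets distribute over arbitrary joins. A filter of $L$ is an upset closed under finite meets (the improper filter is allowed). A filter $\kappa\subseteq L$ is Scott-open if, whenever $D\subseteq L$ is directed and $\bigvee D\in\kappa$, then $d\in\kappa$ for some $d\in D$. $L^{\wedge}$ denotes the set of Scott-open filters of $L$. A canonical extension of a frame $L$ is a monotone map $e\colon L\to L^\delta$ into a complete lattice $L^\delta$ such that: (Dense) for all $u,v\in L^\delta$: $u\le v$ holds provided that for all $\kappa\in L^{\wedge}$ and $a\in L$, the inequalities $\bigwedge e[\kappa]\le u$ and $v\le e(a)$ together imply $\bigwedge e[\kappa]\le e(a)$; (Compact) if $\bigwedge e[\kappa]\le e(a)$ for some $\kappa\in L^{\wedge}$ and $a\in L$, then $a\in\kappa$. Every frame has a canonical extension, unique up to isomorphism. *)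

theory Defs
  imports Main
begin

text \<open>The library class \<^class>\<open>complete_distrib_lattice\<close> asks for complete distributivity,
  which is strictly stronger than the frame law. Distributivity of binary meets suffices:
  nonempty finite meets follow by induction, and the empty one is trivial.\<close>

class frame = complete_lattice +
  assumes inf_Sup_distrib: "inf a (Sup B) = Sup ((\<lambda>b. inf a b) ` B)"

text \<open>The meet of the empty set is \<^term>\<open>top\<close>, so a filter is nonempty. It may be improper.\<close>

definition lattice_filter :: "'a::complete_lattice set \<Rightarrow> bool" where
  "lattice_filter K \<longleftrightarrow>
     (\<forall>a b. a \<in> K \<longrightarrow> a \<le> b \<longrightarrow> b \<in> K) \<and>
     (\<forall>F. finite F \<longrightarrow> F \<subseteq> K \<longrightarrow> Inf F \<in> K)"

definition directed :: "'a::order set \<Rightarrow> bool" where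
  "directed D \<longleftrightarrow> D \<noteq> {} \<and> (\<forall>x\<in>D. \<forall>y\<in>D. \<exists>z\<in>D. x \<le> z \<and> y \<le> z)"

definition scott_open_filters :: "'a::complete_lattice set set" where
  "scott_open_filters =
     {K. lattice_filter K \<and> (\<forall>D. directed D \<longrightarrow> Sup D \<in> K \<longrightarrow> (\<exists>d\<in>D. d \<in> K))}"

definition canonical_extension :: "('a::frame \<Rightarrow> 'b::complete_lattice) \<Rightarrow> bool" where
  "canonical_extension e \<longleftrightarrow>
     mono e \<and>
     (\<forall>u v. (\<forall>K\<in>scott_open_filters. \<forall>a. Inf (e ` K) \<le> u \<and> v \<le> e a \<longrightarrow> Inf (e ` K) \<le> e a)
        \<longrightarrow> u \<le> v) \<and>
     (\<forall>K\<in>scott_open_filters. \<forall>a. Inf (e ` K) \<le> e a \<longrightarrow> a \<in> K)"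

text \<open>The empty family is allowed; its intersection is the improper filter, which is
  itself Scott-open.\<close>

definition intersections_of_scott_open_filters :: "'a::complete_lattice set set" where
  "intersections_of_scott_open_filters =
     {F. lattice_filter F \<and> (\<exists>\<K>\<subseteq>scott_open_filters. F = \<Inter>\<K>)}"

definition poset_isomorphic ::
  "'a set \<Rightarrow> ('a \<Rightarrow> 'a \<Rightarrow> bool) \<Rightarrow> 'b set \<Rightarrow> ('b \<Rightarrow> 'b \<Rightarrow> bool) \<Rightarrow> bool" where
  "poset_isomorphic A leA B leB \<longleftrightarrow>
     (\<exists>f. bij_betw f A B \<and> (\<forall>x\<in>A. \<forall>y\<in>A. leA x y \<longleftrightarrow> leB (f x) (f y)))"

end

theory Submission
  imports Defs
begin

text \<open>Writing \<open>k K\<close> for the meet of \<open>e ` K\<close>, compactness says that \<open>k K \<le> e a\<close> holds precisely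
  when \<open>a \<in> K\<close>, and density makes the elements \<open>e a\<close> meet-dense and the elements \<open>k K\<close>
  join-dense. By meet-density \<open>u\<close> is determined by \<open>{a. u \<le> e a}\<close>; by join-density this set
  is the intersection of the Scott-open filters \<open>K\<close> with \<open>k K \<le> u\<close>.\<close>

lemma lattice_filter_Inter:
  assumes "\<And>K. K \<in> \<K> \<Longrightarrow> lattice_filter K"
  shows "lattice_filter (\<Inter>\<K>)"
  unfolding lattice_filter_def
proof (intro conjI allI impI InterI)
  fix a b K
  assume "a \<in> \<Inter>\<K>" "a \<le> b" "K \<in> \<K>"
  then show "b \<in> K" using assms[of K] unfolding lattice_filter_def by blast
next
  fix F K
  assume "finite F" "F \<subseteq> \<Inter>\<K>" "K \<in> \<K>"
  then show "Inf F \<in> K" using assms[of K] unfolding lattice_filter_def by blast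
qed

text \<open>Lets both inclusions for the range be checked on families of Scott-open filters
  alone.\<close>

lemma intersections_of_scott_open_filters_eq:
  "(intersections_of_scott_open_filters :: 'a::complete_lattice set set) =
     Inter ` Pow scott_open_filters"
proof -
  have "lattice_filter (\<Inter>\<K>)" if "\<K> \<subseteq> scott_open_filters" for \<K> :: "'a set set"
    using that by (intro lattice_filter_Inter) (auto simp: scott_open_filters_def)
  then show ?thesis
    unfolding intersections_of_scott_open_filters_def by blast
qed

context
  fixes e :: "'a::frame \<Rightarrow> 'b::complete_lattice"
  assumes ext: "canonical_extension e"
begin

lemma Inf_image_le_iff:
  assumes "K \<in> scott_open_filters"
  shows "Inf (e ` K) \<le> e a \<longleftrightarrow> a \<in> K"
proof
  have "\<forall>K\<in>scott_open_filters. \<forall>a. Inf (e ` K) \<le> e a \<longrightarrow> a \<in> K"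
    using ext unfolding canonical_extension_def by (elim conjE)
  then show "a \<in> K" if "Inf (e ` K) \<le> e a"
    using assms that by blast
qed (rule INF_lower)

lemma canonical_extension_dense:
  assumes "\<And>K a. K \<in> scott_open_filters \<Longrightarrow> Inf (e ` K) \<le> u \<Longrightarrow> v \<le> e a \<Longrightarrow> Inf (e ` K) \<le> e a"
  shows "u \<le> v"
proof -
  have "\<forall>u v. (\<forall>K\<in>scott_open_filters. \<forall>a. Inf (e ` K) \<le> u \<and> v \<le> e a \<longrightarrow> Inf (e ` K) \<le> e a)
          \<longrightarrow> u \<le> v"
    using ext unfolding canonical_extension_def by (elim conjE)
  then show ?thesis
    by (elim allE[of _ u] allE[of _ v] mp) (intro ballI allI impI, elim conjE, rule assms)
qed

text \<open>The assumption turns \<open>v \<le> e a\<close> into \<open>u \<le> e a\<close>, so the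
  density condition follows by transitivity through \<open>u\<close>.\<close>

lemma canonical_extension_meet_dense:
  assumes "\<And>a. v \<le> e a \<Longrightarrow> u \<le> e a"
  shows "u \<le> v"
  by (rule canonical_extension_dense) (rule order_trans[OF _ assms])

text \<open>Dual argument: here the density condition follows by transitivity through
  \<open>v\<close>.\<close>

lemma canonical_extension_join_dense:
  assumes "\<And>K. K \<in> scott_open_filters \<Longrightarrow> Inf (e ` K) \<le> u \<Longrightarrow> Inf (e ` K) \<le> v"
  shows "u \<le> v"
  by (rule canonical_extension_dense) (rule order_trans[OF assms])

lemma above_eq_Inter:
  "{a. u \<le> e a} = \<Inter>{K \<in> scott_open_filters. Inf (e ` K) \<le> u}"
proof (intro set_eqI iffI)
  fix a
  assume "a \<in> {a. u \<le> e a}"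
  then show "a \<in> \<Inter>{K \<in> scott_open_filters. Inf (e ` K) \<le> u}"
    by (auto simp flip: Inf_image_le_iff intro: order_trans)
next
  fix a
  assume "a \<in> \<Inter>{K \<in> scott_open_filters. Inf (e ` K) \<le> u}"
  then have "Inf (e ` K) \<le> e a" if "K \<in> scott_open_filters" "Inf (e ` K) \<le> u" for K
    using that by (simp add: Inf_image_le_iff)
  then have "u \<le> e a"
    by (rule canonical_extension_join_dense)
  then show "a \<in> {a. u \<le> e a}" by simp
qed

text \<open>A supremum lies below \<open>e a\<close> iff each of its members does, and compactness
  translates this memberwise. This supplies a preimage of \<open>\<Inter>\<K>\<close>; for empty
  \<open>\<K>\<close> it is the bottom element.\<close>

lemma above_Sup_eq_Inter:
  assumes "\<K> \<subseteq> scott_open_filters"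
  shows "{a. (SUP K\<in>\<K>. Inf (e ` K)) \<le> e a} = \<Inter>\<K>"
proof (rule set_eqI)
  fix a
  have "(\<forall>K\<in>\<K>. Inf (e ` K) \<le> e a) \<longleftrightarrow> (\<forall>K\<in>\<K>. a \<in> K)"
    using assms by (intro ball_cong refl Inf_image_le_iff) blast
  then show "a \<in> {a. (SUP K\<in>\<K>. Inf (e ` K)) \<le> e a} \<longleftrightarrow> a \<in> \<Inter>\<K>"
    by (simp only: mem_Collect_eq SUP_le_iff Inter_iff)
qed

text \<open>Meet-density gives the forward direction, transitivity the converse. Besides the order
  condition, this yields injectivity.\<close>

lemma above_superset_iff:
  "{a. u \<le> e a} \<supseteq> {a. v \<le> e a} \<longleftrightarrow> u \<le> v"
proof
  show "{a. u \<le> e a} \<supseteq> {a. v \<le> e a} \<Longrightarrow> u \<le> v"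
    by (rule canonical_extension_meet_dense) blast
qed (auto intro: order_trans)

lemma bij_betw_above:
  "bij_betw (\<lambda>u. {a. u \<le> e a}) UNIV intersections_of_scott_open_filters"
  unfolding bij_betw_def
proof
  show "inj (\<lambda>u. {a. u \<le> e a})"
    \<comment> \<open>Equal sets include each other, so reflecting the order both ways and
      antisymmetry give equal elements.\<close>
    by (intro injI order_antisym; rule above_superset_iff[THEN iffD1]) simp_all
  show "range (\<lambda>u. {a. u \<le> e a}) = intersections_of_scott_open_filters"
  proof
    show "range (\<lambda>u. {a. u \<le> e a}) \<subseteq> intersections_of_scott_open_filters"
      unfolding intersections_of_scott_open_filters_eq above_eq_Inter by blast
    show "intersections_of_scott_open_filters \<subseteq> range (\<lambda>u. {a. u \<le> e a})"
      unfolding intersections_of_scott_open_filters_eq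
    proof (intro image_subsetI)
      fix \<K> :: "'a set set"
      assume "\<K> \<in> Pow scott_open_filters"
      then have "\<Inter>\<K> = {a. (SUP K\<in>\<K>. Inf (e ` K)) \<le> e a}"
        by (intro above_Sup_eq_Inter[symmetric]) blast
      then show "\<Inter>\<K> \<in> range (\<lambda>u. {a. u \<le> e a})"
        by (rule range_eqI)
    qed
  qed
qed

end

theorem corollary4p4:
  fixes e :: "'a::frame \<Rightarrow> 'b::complete_lattice"
  assumes "canonical_extension e"
  shows "poset_isomorphic
           (UNIV :: 'b set) (\<le>)
           (intersections_of_scott_open_filters :: 'a set set) (\<supseteq>)"
  unfolding poset_isomorphic_def
  using bij_betw_above[OF assms] above_superset_iff[OF assms] by blast

end
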